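(* Consider estimation of $\mathbf x_0$ in a generalized linear model with a (possibly mismatched) postulated prior and likelihood. The fixed point equations of the state evolution (SE) of the K-step vector approximate survey propagation (KVASP) algorithm align with the K-step replica-symmetry-breaking (KRSB) saddle point equations of the free energy. Here the SE is the recursion (SE) written out in the context, its fixed point equations are obtained by removing the iteration indices $t$ and $t+1$ from (SE), and the KRSB saddle point equations are the system (SP) written out in the context.
   Context: **Model.** $\mathbf x_0\in\mathbb R^N$ has i.i.d. entries with true prior $p(x_0)$; $\mathbf z_0=\mathbf H\mathbf x_0\in\mathbb R^M$ with $\mathbf H$ an $M\times N$ measurement matrix; $\mathbf y$ is generated componentwise from the true likelihood $p(y|z_0)$. The estimator uses the postulated prior $q(x_0)$ and likelihood $q(y|z_0)$, raised to the power $\beta$: the target is the mean of $\mathbf x_0$ under the density proportional to $q^\beta(\mathbf y|\mathbf H\mathbf x_0)\,q^\beta(\mathbf x_0)$. The limit is $M,N\to\infty$ with $\alpha=M/N$ fixed; $\lambda$ follows the limiting eigenvalue distribution of $\mathbf H^{\mathsf T}\mathbf H$, and $\mathbb E_\lambda$ is the expectation over it. The KRSB parameters are $L_1,\dots,L_K$, where $\tilde L_k=L_k/\beta$ are positive integers and $\tilde L_k/\tilde L_{k-1}$ ($2\le k\le K$) are positive integers; write $L_0:=\beta$. KVASP is the iterative algorithm that propagates Gaussian "surveys" of replicated copies of $\mathbf x_0$ and $\mathbf z_0$ on a replicated factor graph, and (SE) is the scalar recursion describing its dynamics. (SP) consists of the extremum conditions of the replica free energy under the KRSB ansatz. **Constants.**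 $C_{\mathsf x}=\mathbb E[x_0^2]$ and $C_{\mathsf z}=\frac1\alpha\mathbb E_\lambda[\lambda]C_{\mathsf x}$. **Conventions.** $\mathrm N[x|m,v]$ is the Gaussian density in $x$ with mean $m$ and variance $v$. Empty sums are $0$. The symbol $\mathsf w$ stands for $\mathsf x$ or $\mathsf z$, and $(w_0,\tilde w)$ for $(x_0,\tilde x)$ or $(z_0,\tilde z)$. $\int_{\mathsf x}$ means $\int d\mu_{\mathsf x}\,dx_0$ and $\int_{\mathsf z}$ means $\int dy\,dz_0\,d\mu_{\mathsf z}$. **Nested averages.** Given $v_{\mathsf x,0},\dots,v_{\mathsf x,K}$, put $m_{\mathsf x,K}:=\mu_{\mathsf x}$ and $$g_{\mathsf x,0}=\log\int d\tilde x\,\mathrm N[\tilde x|m_{\mathsf x,0},\tfrac1\beta v_{\mathsf x,0}]\,q^\beta(\tilde x),\qquad \langle a\rangle_{\mathsf x,0}=e^{-g_{\mathsf x,0}}\int d\tilde x\,\mathrm N[\tilde x|m_{\mathsf x,0},\tfrac1\beta v_{\mathsf x,0}]\,q^\beta(\tilde x)\,a,$$ and for $1\le k\le K$ $$g_{\mathsf x,k}=\log\int dm_{\mathsf x,k-1}\,\mathrm N[m_{\mathsf x,k-1}|m_{\mathsf x,k},v_{\mathsf x,k}]\,e^{\frac{L_k}{L_{k-1}}g_{\mathsf x,k-1}},\qquad \langle a\rangle_{\mathsf x,k}=e^{-g_{\mathsf x,k}}\int dm_{\mathsf x,k-1}\,\mathrm N[m_{\mathsf x,k-1}|m_{\mathsf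 x,k},v_{\mathsf x,k}]\,e^{\frac{L_k}{L_{k-1}}g_{\mathsf x,k-1}}\,a.$$ $g_{\mathsf z,k}$ and $\langle a\rangle_{\mathsf z,k}$ are defined in the same way with $\mathsf x$ replaced by $\mathsf z$ and $q^\beta(\tilde x)$ replaced by $q^\beta(y|\tilde z)$. The symbol $\langle\cdots\langle a\rangle_{\mathsf w,0}\cdots\rangle_{\mathsf w,K}$ means applying levels $0,1,\dots,K$ successively; $\langle\cdots\langle\cdots\langle a\rangle_{\mathsf w,0}\cdots\rangle^2_{\mathsf w,K-k}\cdots\rangle_{\mathsf w,K}$ means that the result after level $K-k$ is squared and then levels $K-k+1,\dots,K$ are applied. **Weights.** For given $\hat D_{1\mathsf w},\hat F_{1\mathsf w}$ and $\kappa_{\mathsf w}$, with $\hat C_{1\mathsf z}=1/C_{\mathsf z}$, $$a_{\mathsf x}=\mathrm N\Big[\mu_{\mathsf x}\Big|\frac{\hat D_{1\mathsf x}}{\kappa_{\mathsf x}}x_0,\frac{\hat F_{1\mathsf x}}{\kappa_{\mathsf x}^2}\Big]p(x_0),$$ $$a_{\mathsf z}=p(y|z_0)\,\mathrm N\Big[z_0\Big|\frac{\hat D_{1\mathsf z}\kappa_{\mathsf z}}{\hat F_{1\mathsf z}(\hat C_{1\mathsf z}+\hat D_{1\mathsf z}^2/\hat F_{1\mathsf z})}\mu_{\mathsf z},\frac1{\hat C_{1\mathsf z}+\hat D_{1\mathsf z}^2/\hat F_{1\mathsf z}}\Big]\mathrm N\Big[\mu_{\mathsf z}\Big|0,\frac{\hat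 F_{1\mathsf z}(\hat C_{1\mathsf z}+\hat D_{1\mathsf z}^2/\hat F_{1\mathsf z})}{\hat C_{1\mathsf z}\kappa_{\mathsf z}^2}\Big].$$ **(SP): KRSB saddle point equations.** Parameters: $C_{\mathsf w},D_{\mathsf w},F_{\mathsf w},\chi_{\mathsf w},H_{\mathsf w,k}$ and $\hat C_{j\mathsf w},\hat D_{j\mathsf w},\hat F_{j\mathsf w},\hat\chi_{j\mathsf w},\hat H_{j\mathsf w,k}$ for $\mathsf w\in\{\mathsf x,\mathsf z\}$, $j\in\{1,2\}$, $1\le k\le K$. Abbreviate $\kappa_{j\mathsf w,k}=\hat\chi_{j\mathsf w}-\sum_{i=1}^kL_i\hat H_{j\mathsf w,i}$ and $s_{\mathsf w,k}=\chi_{\mathsf w}+\sum_{i=1}^kL_iH_{\mathsf w,i}$ ($0\le k\le K$). The equations, for both $\mathsf w$, are: 0. $C_{\mathsf x}=\mathbb E[x_0^2]$, $\hat C_{1\mathsf x}=0$, $\hat C_{2\mathsf x}=1/C_{\mathsf x}$, $C_{\mathsf z}=\frac1\alpha\mathbb E_\lambda[\lambda]C_{\mathsf x}$, $\hat C_{1\mathsf z}=1/C_{\mathsf z}$, $\hat C_{2\mathsf z}=0$. 1. $0=\hat D_{1\mathsf w}+\hat D_{2\mathsf w}-\frac{D_{\mathsf w}}{C_{\mathsf w}s_{\mathsf w,K}}$; $0=\hat F_{1\mathsf w}+\hat F_{2\mathsf w}+\frac{D_{\mathsf w}^2}{C_{\mathsf w}s_{\mathsf w,K}^2}-\frac{F_{\mathsf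 w}}{s_{\mathsf w,K}^2}$; $0=\hat\chi_{1\mathsf w}+\hat\chi_{2\mathsf w}-\frac1{\chi_{\mathsf w}}$; $0=\hat H_{1\mathsf w,k}+\hat H_{2\mathsf w,k}+\frac1{L_k}\big(\frac1{s_{\mathsf w,k}}-\frac1{s_{\mathsf w,k-1}}\big)$, $1\le k\le K$. 2. With $r_{\mathsf x}(\lambda)=1$, $r_{\mathsf z}(\lambda)=\lambda/\alpha$: $D_{\mathsf w}=C_{\mathsf x}\mathbb E_\lambda\big[r_{\mathsf w}\frac{\hat D_{2\mathsf x}+\lambda\hat D_{2\mathsf z}}{\kappa_{2\mathsf x,K}+\lambda\kappa_{2\mathsf z,K}}\big]$; $F_{\mathsf w}=C_{\mathsf x}\mathbb E_\lambda\big[r_{\mathsf w}\frac{(\hat D_{2\mathsf x}+\lambda\hat D_{2\mathsf z})^2}{(\kappa_{2\mathsf x,K}+\lambda\kappa_{2\mathsf z,K})^2}\big]+\mathbb E_\lambda\big[r_{\mathsf w}\frac{\hat F_{2\mathsf x}+\lambda\hat F_{2\mathsf z}}{(\kappa_{2\mathsf x,K}+\lambda\kappa_{2\mathsf z,K})^2}\big]$; $\chi_{\mathsf w}=\mathbb E_\lambda\big[\frac{r_{\mathsf w}}{\hat\chi_{2\mathsf x}+\lambda\hat\chi_{2\mathsf z}}\big]$; $H_{\mathsf w,k}=\frac1{L_k}\big(\mathbb E_\lambda\big[\frac{r_{\mathsf w}}{\kappa_{2\mathsf x,k}+\lambda\kappa_{2\mathsf z,k}}\big]-\mathbb E_\lambda\big[\frac{r_{\mathsf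 w}}{\kappa_{2\mathsf x,k-1}+\lambda\kappa_{2\mathsf z,k-1}}\big]\big)$, $1\le k\le K$. 3. With nested averages at $v_{\mathsf w,0}=1/\hat\chi_{1\mathsf w}$, $v_{\mathsf w,k}=\frac1{L_k}\big(\frac1{\kappa_{1\mathsf w,k}}-\frac1{\kappa_{1\mathsf w,k-1}}\big)$ ($1\le k\le K$) and weights with $\kappa_{\mathsf w}=\kappa_{1\mathsf w,K}$: $D_{\mathsf w}=\int_{\mathsf w}a_{\mathsf w}w_0\langle\cdots\langle\tilde w\rangle_{\mathsf w,0}\cdots\rangle_{\mathsf w,K}$; $F_{\mathsf w}=\int_{\mathsf w}a_{\mathsf w}\langle\cdots\langle\tilde w\rangle_{\mathsf w,0}\cdots\rangle_{\mathsf w,K}^2$; $F_{\mathsf w}+\frac1\beta\chi_{\mathsf w}+\sum_{k=1}^KH_{\mathsf w,k}=\int_{\mathsf w}a_{\mathsf w}\langle\cdots\langle\tilde w^2\rangle_{\mathsf w,0}\cdots\rangle_{\mathsf w,K}$; $F_{\mathsf w}+\sum_{i=1}^kH_{\mathsf w,i}=\int_{\mathsf w}a_{\mathsf w}\langle\cdots\langle\cdots\langle\tilde w\rangle_{\mathsf w,0}\cdots\rangle^2_{\mathsf w,K-k}\cdots\rangle_{\mathsf w,K}$, $1\le k\le K$. **(SE): state evolution of KVASP.** Initialized with $\hat D^1_{1\mathsf z},\hat F^1_{1\mathsf z},\{c^{+,1}_{\mathsf z,k}\}_{k=0}^K,\hat D^1_{2\mathsf x},\hat F^1_{2\mathsf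 x},\{c^{+,1}_{\mathsf x,k}\}_{k=0}^K$. For $t=1,2,\dots$ compute in order ($k$ runs over $0,\dots,K$ unless stated otherwise): (a) $v^{+,t}_{\mathsf z,0}=c^{+,t}_{\mathsf z,0}$; $v^{+,t}_{\mathsf z,k}=\frac1{L_k}(c^{+,t}_{\mathsf z,k}-c^{+,t}_{\mathsf z,k-1})$, $1\le k\le K$. With nested $\mathsf z$-averages at $v_{\mathsf z,k}=v^{+,t}_{\mathsf z,k}$ and $a^t_{\mathsf z}$ the weight $a_{\mathsf z}$ with $\hat D^t_{1\mathsf z},\hat F^t_{1\mathsf z}$, $\kappa_{\mathsf z}=1/c^{+,t}_{\mathsf z,K}$: $D^{-,t}_{\mathsf z}=\int_{\mathsf z}a^t_{\mathsf z}z_0\langle\cdots\langle\tilde z\rangle_{\mathsf z,0}\cdots\rangle_{\mathsf z,K}$; $F^{-,t}_{\mathsf z}=\int_{\mathsf z}a^t_{\mathsf z}\langle\cdots\langle\tilde z\rangle_{\mathsf z,0}\cdots\rangle^2_{\mathsf z,K}$; $F^{-,t}_{\mathsf z}+\frac1\beta\hat v^{-,t}_{\mathsf z,0}+\sum_{k=1}^K\hat v^{-,t}_{\mathsf z,k}=\int_{\mathsf z}a^t_{\mathsf z}\langle\cdots\langle\tilde z^2\rangle_{\mathsf z,0}\cdots\rangle_{\mathsf z,K}$; $F^{-,t}_{\mathsf z}+\sum_{i=1}^k\hat v^{-,t}_{\mathsf z,i}=\int_{\mathsf z}a^t_{\mathsf z}\langle\cdots\langle\cdots\langle\tilde z\rangle_{\mathsf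 z,0}\cdots\rangle^2_{\mathsf z,K-k}\cdots\rangle_{\mathsf z,K}$, $1\le k\le K$. Then $\hat c^{-,t}_{\mathsf z,0}=\hat v^{-,t}_{\mathsf z,0}$; $\hat c^{-,t}_{\mathsf z,k}=\hat c^{-,t}_{\mathsf z,k-1}+L_k\hat v^{-,t}_{\mathsf z,k}$, $1\le k\le K$; $c^{-,t}_{\mathsf z,k}=(1/\hat c^{-,t}_{\mathsf z,k}-1/c^{+,t}_{\mathsf z,k})^{-1}$; $\hat D^t_{2\mathsf z}=\frac{D^{-,t}_{\mathsf z}}{C_{\mathsf z}\hat c^{-,t}_{\mathsf z,K}}-\hat D^t_{1\mathsf z}$; $\hat F^t_{2\mathsf z}=\frac{F^{-,t}_{\mathsf z}}{(\hat c^{-,t}_{\mathsf z,K})^2}-\frac{(D^{-,t}_{\mathsf z})^2}{C_{\mathsf z}(\hat c^{-,t}_{\mathsf z,K})^2}-\hat F^t_{1\mathsf z}$. (b) With $\Theta_k=\frac1{c^{+,t}_{\mathsf x,k}}+\frac\lambda{c^{-,t}_{\mathsf z,k}}$: $\hat c^{-,t}_{\mathsf x,k}=\mathbb E_\lambda[\Theta_k^{-1}]$; $D^{-,t}_{\mathsf x}=C_{\mathsf x}\mathbb E_\lambda\big[\frac{\hat D^t_{2\mathsf x}+\hat D^t_{2\mathsf z}\lambda}{\Theta_K}\big]$; $F^{-,t}_{\mathsf x}=C_{\mathsf x}\mathbb E_\lambda\big[\frac{(\hat D^t_{2\mathsf x}+\hat D^t_{2\mathsf z}\lambda)^2}{\Theta_K^2}\big]+\mathbb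 E_\lambda\big[\frac{\hat F^t_{2\mathsf x}+\hat F^t_{2\mathsf z}\lambda}{\Theta_K^2}\big]$; $c^{-,t}_{\mathsf x,k}=(1/\hat c^{-,t}_{\mathsf x,k}-1/c^{+,t}_{\mathsf x,k})^{-1}$; $\hat D^t_{1\mathsf x}=\frac{D^{-,t}_{\mathsf x}}{C_{\mathsf x}\hat c^{-,t}_{\mathsf x,K}}-\hat D^t_{2\mathsf x}$; $\hat F^t_{1\mathsf x}=\frac{F^{-,t}_{\mathsf x}}{(\hat c^{-,t}_{\mathsf x,K})^2}-\frac{(D^{-,t}_{\mathsf x})^2}{C_{\mathsf x}(\hat c^{-,t}_{\mathsf x,K})^2}-\hat F^t_{2\mathsf x}$. (c) $v^{-,t}_{\mathsf x,0}=c^{-,t}_{\mathsf x,0}$; $v^{-,t}_{\mathsf x,k}=\frac1{L_k}(c^{-,t}_{\mathsf x,k}-c^{-,t}_{\mathsf x,k-1})$, $1\le k\le K$. With nested $\mathsf x$-averages at $v_{\mathsf x,k}=v^{-,t}_{\mathsf x,k}$ and $a^t_{\mathsf x}$ the weight $a_{\mathsf x}$ with $\hat D^t_{1\mathsf x},\hat F^t_{1\mathsf x}$, $\kappa_{\mathsf x}=1/c^{-,t}_{\mathsf x,K}$: $D^{+,t+1}_{\mathsf x}=\int_{\mathsf x}a^t_{\mathsf x}x_0\langle\cdots\langle\tilde x\rangle_{\mathsf x,0}\cdots\rangle_{\mathsf x,K}$; $F^{+,t+1}_{\mathsf x}=\int_{\mathsf x}a^t_{\mathsf x}\langle\cdots\langle\tilde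 x\rangle_{\mathsf x,0}\cdots\rangle^2_{\mathsf x,K}$; $F^{+,t+1}_{\mathsf x}+\frac1\beta\hat v^{+,t+1}_{\mathsf x,0}+\sum_{k=1}^K\hat v^{+,t+1}_{\mathsf x,k}=\int_{\mathsf x}a^t_{\mathsf x}\langle\cdots\langle\tilde x^2\rangle_{\mathsf x,0}\cdots\rangle_{\mathsf x,K}$; $F^{+,t+1}_{\mathsf x}+\sum_{i=1}^k\hat v^{+,t+1}_{\mathsf x,i}=\int_{\mathsf x}a^t_{\mathsf x}\langle\cdots\langle\cdots\langle\tilde x\rangle_{\mathsf x,0}\cdots\rangle^2_{\mathsf x,K-k}\cdots\rangle_{\mathsf x,K}$, $1\le k\le K$. Then $\hat c^{+,t+1}_{\mathsf x,0}=\hat v^{+,t+1}_{\mathsf x,0}$; $\hat c^{+,t+1}_{\mathsf x,k}=\hat c^{+,t+1}_{\mathsf x,k-1}+L_k\hat v^{+,t+1}_{\mathsf x,k}$, $1\le k\le K$; $c^{+,t+1}_{\mathsf x,k}=(1/\hat c^{+,t+1}_{\mathsf x,k}-1/c^{-,t}_{\mathsf x,k})^{-1}$; $\hat D^{t+1}_{2\mathsf x}=\frac{D^{+,t+1}_{\mathsf x}}{C_{\mathsf x}\hat c^{+,t+1}_{\mathsf x,K}}-\hat D^t_{1\mathsf x}$; $\hat F^{t+1}_{2\mathsf x}=\frac{F^{+,t+1}_{\mathsf x}}{(\hat c^{+,t+1}_{\mathsf x,K})^2}-\frac{(D^{+,t+1}_{\mathsf x})^2}{C_{\mathsf x}(\hat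 c^{+,t+1}_{\mathsf x,K})^2}-\hat F^t_{1\mathsf x}$. (d) With $\Theta'_k=\frac1{c^{+,t+1}_{\mathsf x,k}}+\frac\lambda{c^{-,t}_{\mathsf z,k}}$: $\hat c^{+,t+1}_{\mathsf z,k}=\frac1\alpha\mathbb E_\lambda[\lambda/\Theta'_k]$; $D^{+,t+1}_{\mathsf z}=\frac{C_{\mathsf x}}\alpha\mathbb E_\lambda\big[\frac{\lambda(\hat D^{t+1}_{2\mathsf x}+\hat D^t_{2\mathsf z}\lambda)}{\Theta'_K}\big]$; $F^{+,t+1}_{\mathsf z}=\frac{C_{\mathsf x}}\alpha\mathbb E_\lambda\big[\frac{\lambda(\hat D^{t+1}_{2\mathsf x}+\hat D^t_{2\mathsf z}\lambda)^2}{(\Theta'_K)^2}\big]+\frac1\alpha\mathbb E_\lambda\big[\frac{\lambda(\hat F^{t+1}_{2\mathsf x}+\hat F^t_{2\mathsf z}\lambda)}{(\Theta'_K)^2}\big]$; $c^{+,t+1}_{\mathsf z,k}=(1/\hat c^{+,t+1}_{\mathsf z,k}-1/c^{-,t}_{\mathsf z,k})^{-1}$; $\hat D^{t+1}_{1\mathsf z}=\frac{D^{+,t+1}_{\mathsf z}}{C_{\mathsf z}\hat c^{+,t+1}_{\mathsf z,K}}-\hat D^t_{2\mathsf z}$; $\hat F^{t+1}_{1\mathsf z}=\frac{F^{+,t+1}_{\mathsf z}}{(\hat c^{+,t+1}_{\mathsf z,K})^2}-\frac{(D^{+,t+1}_{\mathsf z})^2}{C_{\mathsf z}(\hat c^{+,t+1}_{\mathsf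 z,K})^2}-\hat F^t_{2\mathsf z}$. **Dictionary between the notations of the two systems** (with iteration indices removed). $\hat D_{j\mathsf w},\hat F_{j\mathsf w}$ denote the same quantities in both; $\hat\chi_{1\mathsf x},\hat\chi_{2\mathsf x},\hat\chi_{1\mathsf z},\hat\chi_{2\mathsf z}$ stand for $1/c_0$ and $\hat H_{1\mathsf x,k},\hat H_{2\mathsf x,k},\hat H_{1\mathsf z,k},\hat H_{2\mathsf z,k}$ for $-\frac1{L_k}\big(\frac1{c_k}-\frac1{c_{k-1}}\big)$, with $c_k=c^-_{\mathsf x,k},\,c^+_{\mathsf x,k},\,c^+_{\mathsf z,k},\,c^-_{\mathsf z,k}$ respectively; and $D_{\mathsf w},F_{\mathsf w},\chi_{\mathsf w},H_{\mathsf w,k}$ stand for $D^-_{\mathsf w},F^-_{\mathsf w},\hat c^-_{\mathsf w,0},\frac1{L_k}(\hat c^-_{\mathsf w,k}-\hat c^-_{\mathsf w,k-1})$. *)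

theory Defs
  imports
    "HOL-Probability.Probability"
    "Jordan_Normal_Form.Char_Poly"
begin

section \<open>The mismatched generalized linear model\<close>

text \<open>
  \<open>true_lik m y z\<close> and \<open>post_lik m y z\<close> are the densities in \<open>y\<close> given \<open>z\<close>.
  The measurement matrices form a sequence \<open>meas m n\<close> of dimension
  \<open>rows m n \<times> cols m n\<close>, and \<open>eig_law m\<close> is the law of \<open>\<lambda>\<close>.
  The field \<open>steps m\<close> is \<open>K\<close>, and \<open>rsb m k\<close> is \<open>L\<^sub>k\<close> with \<open>L\<^sub>0 = \<beta>\<close>.
\<close>

record model =
  true_prior :: "real \<Rightarrow> real"
  true_lik :: "real \<Rightarrow> real \<Rightarrow> real"
  post_prior :: "real \<Rightarrow> real"
  post_lik :: "real \<Rightarrow> real \<Rightarrow> real"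
  beta :: real
  alpha :: real
  steps :: nat
  rsb :: "nat \<Rightarrow> real"
  rows :: "nat \<Rightarrow> nat"
  cols :: "nat \<Rightarrow> nat"
  meas :: "nat \<Rightarrow> real mat"
  eig_law :: "real measure"

definition is_pdf :: "(real \<Rightarrow> real) \<Rightarrow> bool" where
  "is_pdf f \<longleftrightarrow> f \<in> borel_measurable borel \<and> (\<forall>x. 0 \<le> f x) \<and> has_bochner_integral lborel f 1"

definition is_likelihood :: "(real \<Rightarrow> real \<Rightarrow> real) \<Rightarrow> bool" where
  "is_likelihood f \<longleftrightarrow>
     (\<lambda>(y, z). f y z) \<in> borel_measurable (borel \<Otimes>\<^sub>M borel) \<and> (\<forall>z. is_pdf (\<lambda>y. f y z))"

text \<open>Distribution function of the eigenvalues of a square matrix, counted with algebraic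
  multiplicity and normalized by the dimension.\<close>

definition spectral_cdf :: "real mat \<Rightarrow> real \<Rightarrow> real" where
  "spectral_cdf A x =
     (\<Sum>a | poly (char_poly A) a = 0 \<and> a \<le> x. real (Polynomial.order a (char_poly A))) / real (dim_row A)"

definition valid_model :: "model \<Rightarrow> bool" where
  "valid_model m \<longleftrightarrow>
     is_pdf (true_prior m) \<and> integrable lborel (\<lambda>x. x\<^sup>2 * true_prior m x) \<and>
     is_likelihood (true_lik m) \<and> is_pdf (post_prior m) \<and> is_likelihood (post_lik m) \<and>
     0 < beta m \<and> 0 < alpha m \<and>
     rsb m 0 = beta m \<and>
     (\<forall>k\<in>{1..steps m}. \<exists>n::nat. 0 < n \<and> rsb m k / beta m = real n) \<and>
     (\<forall>k\<in>{2..steps m}. \<exists>n::nat. 0 < n \<and>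
        (rsb m k / beta m) / (rsb m (k - 1) / beta m) = real n) \<and>
     (\<forall>n. meas m n \<in> carrier_mat (rows m n) (cols m n)) \<and>
     filterlim (rows m) at_top sequentially \<and> filterlim (cols m) at_top sequentially \<and>
     (\<lambda>n. real (rows m n) / real (cols m n)) \<longlonglongrightarrow> alpha m \<and>
     real_distribution (eig_law m) \<and>
     weak_conv (\<lambda>n. spectral_cdf (transpose_mat (meas m n) * meas m n)) (cdf (eig_law m)) \<and>
     integrable (eig_law m) (\<lambda>l. l) \<and> 0 < integral\<^sup>L (eig_law m) (\<lambda>l. l)"

abbreviation E_eig :: "model \<Rightarrow> (real \<Rightarrow> real) \<Rightarrow> real" where
  "E_eig m f \<equiv> integral\<^sup>L (eig_law m) f"

datatype node = wx | wz

fun C_const :: "model \<Rightarrow> node \<Rightarrow> real" where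
  "C_const m wx = (LBINT x. x\<^sup>2 * true_prior m x)"
| "C_const m wz = 1 / alpha m * E_eig m (\<lambda>l. l) * (LBINT x. x\<^sup>2 * true_prior m x)"


section \<open>Nested averages and scalar channels\<close>

definition gauss_pdf :: "real \<Rightarrow> real \<Rightarrow> real \<Rightarrow> real" where
  "gauss_pdf x mu var = normal_density mu (sqrt var) x"

text \<open>In the following, \<open>v\<close> is the sequence of variances and \<open>Q\<close> is the innermost factor
  (\<open>q\<^sup>\<beta>\<close> of the prior, or of the likelihood at a fixed \<open>y\<close>). The averages
  \<open>avg m v Q k a\<close> are functions of the mean variable of level \<open>k\<close>.\<close>

primrec glog :: "model \<Rightarrow> (nat \<Rightarrow> real) \<Rightarrow> (real \<Rightarrow> real) \<Rightarrow> nat \<Rightarrow> real \<Rightarrow> real" where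
  "glog m v Q 0 mu = ln (LBINT t. gauss_pdf t mu (1 / beta m * v 0) * Q t)"
| "glog m v Q (Suc k) mu =
     ln (LBINT t. gauss_pdf t mu (v (Suc k)) * exp (rsb m (Suc k) / rsb m k * glog m v Q k t))"

primrec avg :: "model \<Rightarrow> (nat \<Rightarrow> real) \<Rightarrow> (real \<Rightarrow> real) \<Rightarrow> nat \<Rightarrow> (real \<Rightarrow> real) \<Rightarrow> real \<Rightarrow> real" where
  "avg m v Q 0 a = (\<lambda>mu. exp (- glog m v Q 0 mu) *
     (LBINT t. gauss_pdf t mu (1 / beta m * v 0) * Q t * a t))"
| "avg m v Q (Suc k) a = (\<lambda>mu. exp (- glog m v Q (Suc k) mu) *
     (LBINT t. gauss_pdf t mu (v (Suc k)) * exp (rsb m (Suc k) / rsb m k * glog m v Q k t) * a t))"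

text \<open>Levels \<open>i, i + 1, \<dots>, j\<close> are applied in this order; nothing is applied if \<open>i > j\<close>.\<close>

definition avgs ::
    "model \<Rightarrow> (nat \<Rightarrow> real) \<Rightarrow> (real \<Rightarrow> real) \<Rightarrow> nat \<Rightarrow> nat \<Rightarrow> (real \<Rightarrow> real) \<Rightarrow> real \<Rightarrow> real" where
  "avgs m v Q i j a = fold (avg m v Q) [i..<Suc j] a"

fun post_pow :: "model \<Rightarrow> node \<Rightarrow> real \<Rightarrow> real \<Rightarrow> real" where
  "post_pow m wx y t = post_prior m t powr beta m"
| "post_pow m wz y t = post_lik m y t powr beta m"

definition weight_x :: "model \<Rightarrow> real \<Rightarrow> real \<Rightarrow> real \<Rightarrow> real \<Rightarrow> real \<Rightarrow> real" where
  "weight_x m Dh Fh \<kappa> mu x0 = gauss_pdf mu (Dh / \<kappa> * x0) (Fh / \<kappa>\<^sup>2) * true_prior m x0"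

definition weight_z :: "model \<Rightarrow> real \<Rightarrow> real \<Rightarrow> real \<Rightarrow> real \<Rightarrow> real \<Rightarrow> real \<Rightarrow> real" where
  "weight_z m Dh Fh \<kappa> y z0 mu =
     (let Ch = 1 / C_const m wz in
      true_lik m y z0 *
      gauss_pdf z0 (Dh * \<kappa> / (Fh * (Ch + Dh\<^sup>2 / Fh)) * mu) (1 / (Ch + Dh\<^sup>2 / Fh)) *
      gauss_pdf mu 0 (Fh * (Ch + Dh\<^sup>2 / Fh) / (Ch * \<kappa>\<^sup>2)))"

text \<open>The weighted outer integral of \<open>h y w\<^sub>0 \<mu>\<close>. There is no \<open>y\<close> on the prior side, so a
  dummy value is passed there; \<^const>\<open>post_pow\<close> ignores it.\<close>

fun chan_int :: "model \<Rightarrow> node \<Rightarrow> real \<Rightarrow> real \<Rightarrow> real \<Rightarrow> (real \<Rightarrow> real \<Rightarrow> real \<Rightarrow> real) \<Rightarrow> real" where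
  "chan_int m wx Dh Fh \<kappa> h =
     (\<integral>(mu, x0). weight_x m Dh Fh \<kappa> mu x0 * h 0 x0 mu \<partial>(lborel \<Otimes>\<^sub>M lborel))"
| "chan_int m wz Dh Fh \<kappa> h =
     (\<integral>(y, z0, mu). weight_z m Dh Fh \<kappa> y z0 mu * h y z0 mu
        \<partial>(lborel \<Otimes>\<^sub>M (lborel \<Otimes>\<^sub>M lborel)))"

text \<open>The four scalar-channel equations, with unknowns \<open>D\<close>, \<open>F\<close>, \<open>h 0\<close> and
  \<open>h 1, \<dots>, h K\<close> on the left-hand sides.\<close>

definition channel_eqs :: "model \<Rightarrow> node \<Rightarrow> (nat \<Rightarrow> real) \<Rightarrow> real \<Rightarrow> real \<Rightarrow> real \<Rightarrow>
    real \<Rightarrow> real \<Rightarrow> (nat \<Rightarrow> real) \<Rightarrow> bool" where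
  "channel_eqs m w v Dh Fh \<kappa> D F h \<longleftrightarrow>
     (let K = steps m; A = (\<lambda>y. avgs m v (post_pow m w y)); I = chan_int m w Dh Fh \<kappa> in
      D = I (\<lambda>y w0 mu. w0 * A y 0 K (\<lambda>t. t) mu) \<and>
      F = I (\<lambda>y w0 mu. (A y 0 K (\<lambda>t. t) mu)\<^sup>2) \<and>
      F + 1 / beta m * h 0 + (\<Sum>k=1..K. h k) = I (\<lambda>y w0 mu. A y 0 K (\<lambda>t. t\<^sup>2) mu) \<and>
      (\<forall>k\<in>{1..K}. F + (\<Sum>i=1..k. h i) =
         I (\<lambda>y w0 mu. A y (K - k + 1) K (\<lambda>u. (A y 0 (K - k) (\<lambda>t. t) u)\<^sup>2) mu)))"


section \<open>The KRSB saddle point equations\<close>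

text \<open>The first argument of a hatted parameter is the index \<open>j \<in> {1, 2}\<close>.\<close>

record sp_vars =
  sp_C :: "node \<Rightarrow> real"
  sp_D :: "node \<Rightarrow> real"
  sp_F :: "node \<Rightarrow> real"
  sp_chi :: "node \<Rightarrow> real"
  sp_H :: "node \<Rightarrow> nat \<Rightarrow> real"
  sp_Ch :: "nat \<Rightarrow> node \<Rightarrow> real"
  sp_Dh :: "nat \<Rightarrow> node \<Rightarrow> real"
  sp_Fh :: "nat \<Rightarrow> node \<Rightarrow> real"
  sp_chih :: "nat \<Rightarrow> node \<Rightarrow> real"
  sp_Hh :: "nat \<Rightarrow> node \<Rightarrow> nat \<Rightarrow> real"

definition sp_kappa :: "model \<Rightarrow> sp_vars \<Rightarrow> nat \<Rightarrow> node \<Rightarrow> nat \<Rightarrow> real" where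
  "sp_kappa m s j w k = sp_chih s j w - (\<Sum>i=1..k. rsb m i * sp_Hh s j w i)"

definition sp_s :: "model \<Rightarrow> sp_vars \<Rightarrow> node \<Rightarrow> nat \<Rightarrow> real" where
  "sp_s m s w k = sp_chi s w + (\<Sum>i=1..k. rsb m i * sp_H s w i)"

definition sp_v :: "model \<Rightarrow> sp_vars \<Rightarrow> node \<Rightarrow> nat \<Rightarrow> real" where
  "sp_v m s w k =
     (if k = 0 then 1 / sp_chih s 1 w
      else 1 / rsb m k * (1 / sp_kappa m s 1 w k - 1 / sp_kappa m s 1 w (k - 1)))"

fun r_fun :: "model \<Rightarrow> node \<Rightarrow> real \<Rightarrow> real" where
  "r_fun m wx l = 1"
| "r_fun m wz l = l / alpha m"

definition sp_constants :: "model \<Rightarrow> sp_vars \<Rightarrow> bool" where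
  "sp_constants m s \<longleftrightarrow>
     sp_C s wx = C_const m wx \<and> sp_Ch s 1 wx = 0 \<and> sp_Ch s 2 wx = 1 / sp_C s wx \<and>
     sp_C s wz = 1 / alpha m * E_eig m (\<lambda>l. l) * sp_C s wx \<and>
     sp_Ch s 1 wz = 1 / sp_C s wz \<and> sp_Ch s 2 wz = 0"

definition sp_matching :: "model \<Rightarrow> sp_vars \<Rightarrow> node \<Rightarrow> bool" where
  "sp_matching m s w \<longleftrightarrow>
     (let K = steps m; S = sp_s m s w in
      0 = sp_Dh s 1 w + sp_Dh s 2 w - sp_D s w / (sp_C s w * S K) \<and>
      0 = sp_Fh s 1 w + sp_Fh s 2 w + (sp_D s w)\<^sup>2 / (sp_C s w * (S K)\<^sup>2) - sp_F s w / (S K)\<^sup>2 \<and>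
      0 = sp_chih s 1 w + sp_chih s 2 w - 1 / sp_chi s w \<and>
      (\<forall>k\<in>{1..K}. 0 = sp_Hh s 1 w k + sp_Hh s 2 w k + 1 / rsb m k * (1 / S k - 1 / S (k - 1))))"

definition sp_linear :: "model \<Rightarrow> sp_vars \<Rightarrow> node \<Rightarrow> bool" where
  "sp_linear m s w \<longleftrightarrow>
     (let K = steps m; r = r_fun m w;
          \<Theta> = (\<lambda>k l. sp_kappa m s 2 wx k + l * sp_kappa m s 2 wz k) in
      sp_D s w = sp_C s wx * E_eig m (\<lambda>l. r l * ((sp_Dh s 2 wx + l * sp_Dh s 2 wz) / \<Theta> K l)) \<and>
      sp_F s w =
        sp_C s wx * E_eig m (\<lambda>l. r l * ((sp_Dh s 2 wx + l * sp_Dh s 2 wz)\<^sup>2 / (\<Theta> K l)\<^sup>2)) +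
        E_eig m (\<lambda>l. r l * ((sp_Fh s 2 wx + l * sp_Fh s 2 wz) / (\<Theta> K l)\<^sup>2)) \<and>
      sp_chi s w = E_eig m (\<lambda>l. r l / (sp_chih s 2 wx + l * sp_chih s 2 wz)) \<and>
      (\<forall>k\<in>{1..K}. sp_H s w k =
         1 / rsb m k * (E_eig m (\<lambda>l. r l / \<Theta> k l) - E_eig m (\<lambda>l. r l / \<Theta> (k - 1) l))))"

definition sp_channel :: "model \<Rightarrow> sp_vars \<Rightarrow> node \<Rightarrow> bool" where
  "sp_channel m s w \<longleftrightarrow>
     channel_eqs m w (sp_v m s w) (sp_Dh s 1 w) (sp_Fh s 1 w) (sp_kappa m s 1 w (steps m))
       (sp_D s w) (sp_F s w) (\<lambda>k. if k = 0 then sp_chi s w else sp_H s w k)"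

definition saddle_point :: "model \<Rightarrow> sp_vars \<Rightarrow> bool" where
  "saddle_point m s \<longleftrightarrow>
     sp_constants m s \<and> (\<forall>w. sp_matching m s w \<and> sp_linear m s w \<and> sp_channel m s w)"

text \<open>Admissibility: denominators do not vanish and variances of Gaussian densities are positive.
  For \<open>j = 2\<close>, the condition on \<^const>\<open>sp_kappa\<close> says that the numbers \<open>c\<^sub>k\<close> with
  \<open>1 / c\<^sub>k = sp_kappa m s 2 w k\<close> exist.\<close>

definition sp_admissible :: "model \<Rightarrow> sp_vars \<Rightarrow> bool" where
  "sp_admissible m s \<longleftrightarrow>
     (\<forall>w. 0 < sp_Fh s 1 w \<and>
        (\<forall>k\<le>steps m. 0 < sp_v m s w k \<and> sp_s m s w k \<noteq> 0 \<and>
           sp_kappa m s 1 w k \<noteq> 0 \<and> sp_kappa m s 2 w k \<noteq> 0)) \<and>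
     (\<forall>k\<le>steps m. AE l in eig_law m. sp_kappa m s 2 wx k + l * sp_kappa m s 2 wz k \<noteq> 0)"


section \<open>The state evolution of KVASP\<close>

text \<open>All quantities carrying one iteration index. The suffixes \<open>p\<close> and \<open>m\<close> stand for the
  superscripts \<open>+\<close> and \<open>-\<close>; \<open>c\<close>, \<open>ch\<close>, \<open>v\<close>, \<open>vh\<close> for
  plain and hatted \<open>c\<close> and \<open>v\<close>; for \<open>v\<close> only the four families below occur.\<close>

record se_vars =
  se_cp :: "node \<Rightarrow> nat \<Rightarrow> real"
  se_cm :: "node \<Rightarrow> nat \<Rightarrow> real"
  se_chp :: "node \<Rightarrow> nat \<Rightarrow> real"
  se_chm :: "node \<Rightarrow> nat \<Rightarrow> real"
  se_Dp :: "node \<Rightarrow> real"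
  se_Dm :: "node \<Rightarrow> real"
  se_Fp :: "node \<Rightarrow> real"
  se_Fm :: "node \<Rightarrow> real"
  se_Dh :: "nat \<Rightarrow> node \<Rightarrow> real"
  se_Fh :: "nat \<Rightarrow> node \<Rightarrow> real"
  se_vzp :: "nat \<Rightarrow> real"
  se_vhzm :: "nat \<Rightarrow> real"
  se_vxm :: "nat \<Rightarrow> real"
  se_vhxp :: "nat \<Rightarrow> real"

text \<open>In the following, \<open>e\<close> collects the quantities at iteration \<open>t\<close> and \<open>e'\<close> those at
  iteration \<open>t + 1\<close>.\<close>

definition se_a :: "model \<Rightarrow> se_vars \<Rightarrow> bool" where
  "se_a m e \<longleftrightarrow>
     (let K = steps m; C = C_const m wz in
      se_vzp e 0 = se_cp e wz 0 \<and>
      (\<forall>k\<in>{1..K}. se_vzp e k = 1 / rsb m k * (se_cp e wz k - se_cp e wz (k - 1))) \<and>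
      channel_eqs m wz (se_vzp e) (se_Dh e 1 wz) (se_Fh e 1 wz) (1 / se_cp e wz K)
        (se_Dm e wz) (se_Fm e wz) (se_vhzm e) \<and>
      se_chm e wz 0 = se_vhzm e 0 \<and>
      (\<forall>k\<in>{1..K}. se_chm e wz k = se_chm e wz (k - 1) + rsb m k * se_vhzm e k) \<and>
      (\<forall>k\<le>K. se_cm e wz k = inverse (1 / se_chm e wz k - 1 / se_cp e wz k)) \<and>
      se_Dh e 2 wz = se_Dm e wz / (C * se_chm e wz K) - se_Dh e 1 wz \<and>
      se_Fh e 2 wz = se_Fm e wz / (se_chm e wz K)\<^sup>2 - (se_Dm e wz)\<^sup>2 / (C * (se_chm e wz K)\<^sup>2)
        - se_Fh e 1 wz)"

definition se_b :: "model \<Rightarrow> se_vars \<Rightarrow> bool" where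
  "se_b m e \<longleftrightarrow>
     (let K = steps m; C = C_const m wx;
          \<Theta> = (\<lambda>k l. 1 / se_cp e wx k + l / se_cm e wz k) in
      (\<forall>k\<le>K. se_chm e wx k = E_eig m (\<lambda>l. inverse (\<Theta> k l))) \<and>
      se_Dm e wx = C * E_eig m (\<lambda>l. (se_Dh e 2 wx + se_Dh e 2 wz * l) / \<Theta> K l) \<and>
      se_Fm e wx = C * E_eig m (\<lambda>l. (se_Dh e 2 wx + se_Dh e 2 wz * l)\<^sup>2 / (\<Theta> K l)\<^sup>2) +
        E_eig m (\<lambda>l. (se_Fh e 2 wx + se_Fh e 2 wz * l) / (\<Theta> K l)\<^sup>2) \<and>
      (\<forall>k\<le>K. se_cm e wx k = inverse (1 / se_chm e wx k - 1 / se_cp e wx k)) \<and>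
      se_Dh e 1 wx = se_Dm e wx / (C * se_chm e wx K) - se_Dh e 2 wx \<and>
      se_Fh e 1 wx = se_Fm e wx / (se_chm e wx K)\<^sup>2 - (se_Dm e wx)\<^sup>2 / (C * (se_chm e wx K)\<^sup>2)
        - se_Fh e 2 wx)"

definition se_c :: "model \<Rightarrow> se_vars \<Rightarrow> se_vars \<Rightarrow> bool" where
  "se_c m e e' \<longleftrightarrow>
     (let K = steps m; C = C_const m wx in
      se_vxm e 0 = se_cm e wx 0 \<and>
      (\<forall>k\<in>{1..K}. se_vxm e k = 1 / rsb m k * (se_cm e wx k - se_cm e wx (k - 1))) \<and>
      channel_eqs m wx (se_vxm e) (se_Dh e 1 wx) (se_Fh e 1 wx) (1 / se_cm e wx K)
        (se_Dp e' wx) (se_Fp e' wx) (se_vhxp e') \<and>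
      se_chp e' wx 0 = se_vhxp e' 0 \<and>
      (\<forall>k\<in>{1..K}. se_chp e' wx k = se_chp e' wx (k - 1) + rsb m k * se_vhxp e' k) \<and>
      (\<forall>k\<le>K. se_cp e' wx k = inverse (1 / se_chp e' wx k - 1 / se_cm e wx k)) \<and>
      se_Dh e' 2 wx = se_Dp e' wx / (C * se_chp e' wx K) - se_Dh e 1 wx \<and>
      se_Fh e' 2 wx =
        se_Fp e' wx / (se_chp e' wx K)\<^sup>2 - (se_Dp e' wx)\<^sup>2 / (C * (se_chp e' wx K)\<^sup>2)
        - se_Fh e 1 wx)"

definition se_d :: "model \<Rightarrow> se_vars \<Rightarrow> se_vars \<Rightarrow> bool" where
  "se_d m e e' \<longleftrightarrow>
     (let K = steps m; Cx = C_const m wx; C = C_const m wz;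
          \<Theta> = (\<lambda>k l. 1 / se_cp e' wx k + l / se_cm e wz k) in
      (\<forall>k\<le>K. se_chp e' wz k = 1 / alpha m * E_eig m (\<lambda>l. l / \<Theta> k l)) \<and>
      se_Dp e' wz =
        Cx / alpha m * E_eig m (\<lambda>l. l * (se_Dh e' 2 wx + se_Dh e 2 wz * l) / \<Theta> K l) \<and>
      se_Fp e' wz =
        Cx / alpha m * E_eig m (\<lambda>l. l * (se_Dh e' 2 wx + se_Dh e 2 wz * l)\<^sup>2 / (\<Theta> K l)\<^sup>2) +
        1 / alpha m * E_eig m (\<lambda>l. l * (se_Fh e' 2 wx + se_Fh e 2 wz * l) / (\<Theta> K l)\<^sup>2) \<and>
      (\<forall>k\<le>K. se_cp e' wz k = inverse (1 / se_chp e' wz k - 1 / se_cm e wz k)) \<and>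
      se_Dh e' 1 wz = se_Dp e' wz / (C * se_chp e' wz K) - se_Dh e 2 wz \<and>
      se_Fh e' 1 wz =
        se_Fp e' wz / (se_chp e' wz K)\<^sup>2 - (se_Dp e' wz)\<^sup>2 / (C * (se_chp e' wz K)\<^sup>2)
        - se_Fh e 2 wz)"

definition state_evolution :: "model \<Rightarrow> (nat \<Rightarrow> se_vars) \<Rightarrow> bool" where
  "state_evolution m e \<longleftrightarrow>
     (\<forall>t\<ge>1. se_a m (e t) \<and> se_b m (e t) \<and> se_c m (e t) (e (t + 1)) \<and> se_d m (e t) (e (t + 1)))"

text \<open>Removing the iteration indices amounts to inserting a constant trajectory.\<close>

definition se_fixed_point :: "model \<Rightarrow> se_vars \<Rightarrow> bool" where
  "se_fixed_point m e \<longleftrightarrow> state_evolution m (\<lambda>t. e)"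

text \<open>Admissibility at a fixed point, as for the saddle point equations. The differences that are
  inverted in the recursion are covered: in HOL a vanishing one would make the resulting
  \<open>c\<^sub>k\<close> zero.\<close>

definition se_admissible :: "model \<Rightarrow> se_vars \<Rightarrow> bool" where
  "se_admissible m e \<longleftrightarrow>
     (\<forall>w. 0 < se_Fh e 1 w \<and>
        (\<forall>k\<le>steps m. se_cp e w k \<noteq> 0 \<and> se_cm e w k \<noteq> 0 \<and>
           se_chp e w k \<noteq> 0 \<and> se_chm e w k \<noteq> 0)) \<and>
     (\<forall>k\<le>steps m. 0 < se_vzp e k \<and> 0 < se_vxm e k) \<and>
     (\<forall>k\<le>steps m. AE l in eig_law m. 1 / se_cp e wx k + l / se_cm e wz k \<noteq> 0)"


section \<open>The dictionary\<close>

fun dict_c :: "se_vars \<Rightarrow> nat \<Rightarrow> node \<Rightarrow> nat \<Rightarrow> real" where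
  "dict_c e j wx = (if j = 1 then se_cm e wx else se_cp e wx)"
| "dict_c e j wz = (if j = 1 then se_cp e wz else se_cm e wz)"

definition dictionary :: "model \<Rightarrow> se_vars \<Rightarrow> sp_vars \<Rightarrow> bool" where
  "dictionary m e s \<longleftrightarrow>
     (\<forall>w. (\<forall>j\<in>{1, 2}.
        sp_Dh s j w = se_Dh e j w \<and> sp_Fh s j w = se_Fh e j w \<and>
        sp_chih s j w = 1 / dict_c e j w 0 \<and>
        (\<forall>k\<in>{1..steps m}. sp_Hh s j w k =
           - (1 / rsb m k * (1 / dict_c e j w k - 1 / dict_c e j w (k - 1))))) \<and>
      sp_D s w = se_Dm e w \<and> sp_F s w = se_Fm e w \<and> sp_chi s w = se_chm e w 0 \<and>
      (\<forall>k\<in>{1..steps m}. sp_H s w k = 1 / rsb m k * (se_chm e w k - se_chm e w (k - 1))))"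

end

theory Submission
  imports Defs
begin

text \<open>
  Inserting a constant trajectory, the extrinsic updates of the recursion say that the precisions
  add up, \<open>1 / c\<^sup>+\<^sub>k + 1 / c\<^sup>-\<^sub>k = 1 / ch\<^sup>-\<^sub>k = 1 / ch\<^sup>+\<^sub>k\<close>, on both sides. Hence the two hatted
  families agree, and since \<open>C\<^sub>w > 0\<close> the two values of \<open>D\<close> and of \<open>F\<close> agree as well. The increments
  \<open>H\<close> of the replica parameters are difference quotients of these sequences, so by telescoping
  \<open>\<kappa>\<^sub>k = 1 / c\<^sub>k\<close> and \<open>s\<^sub>k = ch\<^sub>k\<close>, and the two systems become literally the same.
\<close>

section \<open>Positivity of the constants and telescoping sums\<close>

lemma all_node: "(\<forall>w. P w) \<longleftrightarrow> P wx \<and> P wz"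
  by (metis node.exhaust)

text \<open>A density with vanishing second moment would be 0 almost everywhere off the null set
  {0}, hence could not integrate to 1. Positivity lets \<open>C_const\<close> be cancelled when the
  two values of D are compared.\<close>

lemma C_const_pos:
  assumes "valid_model m"
  shows "0 < C_const m w"
proof -
  define p where "p = true_prior m"
  from assms have p: "\<And>x. 0 \<le> p x" "has_bochner_integral lborel p 1"
    and int: "integrable lborel (\<lambda>x. x\<^sup>2 * p x)"
    and aE: "0 < alpha m" "0 < E_eig m (\<lambda>l. l)"
    by (auto simp: valid_model_def is_pdf_def p_def)
  have "(LBINT x. x\<^sup>2 * p x) \<noteq> 0"
  proof
    assume "(LBINT x. x\<^sup>2 * p x) = 0"
    then have "AE x in lborel. x\<^sup>2 * p x = 0"
      using integral_nonneg_eq_0_iff_AE[OF int] p(1) by simp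
    then have "AE x in lborel. p x = 0"
      using AE_lborel_singleton[of 0] by eventually_elim simp
    then have "integral\<^sup>L lborel p = 0"
      by (rule integral_eq_zero_AE)
    with p(2) show False
      by (simp add: has_bochner_integral_integral_eq)
  qed
  moreover have "0 \<le> (LBINT x. x\<^sup>2 * p x)"
    using p(1) by (intro Bochner_Integration.integral_nonneg) simp
  ultimately have "0 < (LBINT x. x\<^sup>2 * p x)"
    by simp
  with aE show ?thesis
    by (cases w) (auto simp: p_def)
qed

text \<open>\<open>sp_linear\<close> keeps the factor 1/\<alpha> inside the expectation,
  \<open>se_d\<close> outside. A nonintegrable function has integral 0, so the constant comes out in
  every case.\<close>

lemma E_eig_r_fun_wz:
  "E_eig m (\<lambda>l. r_fun m wz l * f l / g l) = E_eig m (\<lambda>l. l * f l / g l) / alpha m"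
  "E_eig m (\<lambda>l. r_fun m wz l / f l) = E_eig m (\<lambda>l. l / f l) / alpha m"
proof -
  have "r_fun m wz l * f l / g l = l * f l / g l / alpha m" "r_fun m wz l / f l = l / f l / alpha m" for l
    by simp_all
  then show "E_eig m (\<lambda>l. r_fun m wz l * f l / g l) = E_eig m (\<lambda>l. l * f l / g l) / alpha m"
    "E_eig m (\<lambda>l. r_fun m wz l / f l) = E_eig m (\<lambda>l. l / f l) / alpha m"
    by (simp_all only: integral_divide_zero)
qed

lemma rsb_pos:
  assumes "valid_model m" "k \<le> steps m"
  shows "0 < rsb m k"
proof (cases "k = 0")
  case True
  with assms show ?thesis by (simp add: valid_model_def)
next
  case False
  have "\<forall>k\<in>{1..steps m}. \<exists>n::nat. 0 < n \<and> rsb m k / beta m = real n" and "0 < beta m"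
    using assms(1) unfolding valid_model_def by blast+
  with assms(2) False obtain n :: nat where "0 < n" "rsb m k / beta m = real n"
    by (metis One_nat_def Suc_leI atLeastAtMost_iff neq0_conv)
  with \<open>0 < beta m\<close> have "rsb m k = real n * beta m"
    by (simp only: divide_eq_eq split: if_split)
  with \<open>0 < n\<close> \<open>0 < beta m\<close> show ?thesis
    by simp
qed

lemma sum_telescope_from_1:
  fixes f d :: "nat \<Rightarrow> real"
  assumes "\<And>i. 1 \<le> i \<Longrightarrow> i \<le> k \<Longrightarrow> d i = f i - f (i - 1)"
  shows "(\<Sum>i=1..k. d i) = f k - f 0"
  using assms
proof (induction k)
  case (Suc k)
  then have "(\<Sum>i=1..k. d i) = f k - f 0" "d (Suc k) = f (Suc k) - f k"
    by fastforce+
  then show ?case by simp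
qed simp

section \<open>Dependence of the nested averages on finitely many variances\<close>

lemma glog_cong:
  assumes "\<And>i. i \<le> k \<Longrightarrow> v i = v' i"
  shows "glog m v Q k = glog m v' Q k"
  using assms by (induction k) (auto simp: fun_eq_iff)

lemma avg_cong:
  assumes "\<And>i. i \<le> k \<Longrightarrow> v i = v' i"
  shows "avg m v Q k = avg m v' Q k"
proof (cases k)
  case 0
  with assms show ?thesis
    by (intro ext) simp
next
  case (Suc j)
  \<comment> \<open>Level \<open>k\<close> normalizes with its own \<open>glog\<close> and reweights
    with that of level \<open>j\<close>.\<close>
  have "glog m v Q k = glog m v' Q k" "glog m v Q j = glog m v' Q j"
    using assms Suc by (auto intro!: glog_cong)
  with assms[of k] Suc show ?thesis
    by (intro ext) (simp del: glog.simps)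
qed

lemma avgs_cong:
  assumes "\<And>i. i \<le> j \<Longrightarrow> v i = v' i"
  shows "avgs m v Q i j = avgs m v' Q i j"
  unfolding avgs_def
  by (intro ext fun_cong[OF fold_cong] refl avg_cong assms) auto

text \<open>Both systems constrain their sequences only up to index K, so the sequences to be
  exchanged agree only there, not as functions.\<close>

lemma channel_eqs_cong:
  assumes "\<And>k. k \<le> steps m \<Longrightarrow> v k = v' k" "\<And>k. k \<le> steps m \<Longrightarrow> h k = h' k"
  shows "channel_eqs m w v Dh Fh \<kappa> D F h \<longleftrightarrow> channel_eqs m w v' Dh Fh \<kappa> D F h'"
proof -
  have "avgs m v Q i j = avgs m v' Q i j" if "j \<le> steps m" for Q i j
    using assms(1) that by (intro avgs_cong) auto
  moreover have "(\<Sum>i=1..k. h i) = (\<Sum>i=1..k. h' i)" if "k \<le> steps m" for k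
    using assms(2) that by (intro sum.cong) auto
  ultimately show ?thesis
    using assms(2)[of 0] by (simp add: channel_eqs_def Let_def)
qed

text \<open>The junk value \<open>inverse 0 = 0\<close> is what makes \<open>c \<noteq> 0\<close> sufficient here.\<close>

lemma extrinsic_iff:
  fixes c c' ch :: real
  assumes "c \<noteq> 0"
  shows "c = inverse (1 / ch - 1 / c') \<longleftrightarrow> 1 / ch = 1 / c + 1 / c'"
  using assms by (metis add_diff_cancel_right' diff_add_cancel inverse_eq_divide inverse_inverse_eq)

subsection \<open>From the state evolution to the saddle point\<close>

text \<open>The dictionary determines every field used here except \<open>sp_C\<close> and
  \<open>sp_Ch\<close>, which come from the equations for the constants. The test
  \<open>(j = 1) = (w = wx)\<close> selects the two vanishing entries, (1, x) and (2, z).\<close>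

definition sp_of_se :: "model \<Rightarrow> se_vars \<Rightarrow> sp_vars" where
  "sp_of_se m e = \<lparr>
     sp_C = C_const m,
     sp_D = se_Dm e,
     sp_F = se_Fm e,
     sp_chi = (\<lambda>w. se_chm e w 0),
     sp_H = (\<lambda>w k. 1 / rsb m k * (se_chm e w k - se_chm e w (k - 1))),
     sp_Ch = (\<lambda>j w. if (j = 1) = (w = wx) then 0 else 1 / C_const m w),
     sp_Dh = se_Dh e,
     sp_Fh = se_Fh e,
     sp_chih = (\<lambda>j w. 1 / dict_c e j w 0),
     sp_Hh = (\<lambda>j w k. - (1 / rsb m k * (1 / dict_c e j w k - 1 / dict_c e j w (k - 1))))\<rparr>"

lemma sp_of_se_sel:
  "sp_C (sp_of_se m e) = C_const m"
  "sp_D (sp_of_se m e) = se_Dm e"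
  "sp_F (sp_of_se m e) = se_Fm e"
  "sp_chi (sp_of_se m e) w = se_chm e w 0"
  "sp_H (sp_of_se m e) w k = 1 / rsb m k * (se_chm e w k - se_chm e w (k - 1))"
  "sp_Dh (sp_of_se m e) = se_Dh e"
  "sp_Fh (sp_of_se m e) = se_Fh e"
  "sp_chih (sp_of_se m e) j w = 1 / dict_c e j w 0"
  "sp_Hh (sp_of_se m e) j w k = - (1 / rsb m k * (1 / dict_c e j w k - 1 / dict_c e j w (k - 1)))"
  by (simp_all add: sp_of_se_def)

lemma dictionary_sp_of_se: "dictionary m e (sp_of_se m e)"
  by (simp add: dictionary_def sp_of_se_def)

text \<open>Each \<open>rsb m i\<close> cancels the prefactor of \<open>sp_Hh\<close>, leaving
  increments of -1/c, whose sum telescopes.\<close>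

lemma sp_kappa_sp_of_se:
  assumes "valid_model m" "k \<le> steps m"
  shows "sp_kappa m (sp_of_se m e) j w k = 1 / dict_c e j w k"
proof -
  have "(\<Sum>i=1..k. rsb m i * sp_Hh (sp_of_se m e) j w i) = - (1 / dict_c e j w k) - - (1 / dict_c e j w 0)"
  proof (rule sum_telescope_from_1)
    fix i assume "1 \<le> i" "i \<le> k"
    with rsb_pos[OF assms(1), of i] assms(2)
    show "rsb m i * sp_Hh (sp_of_se m e) j w i = - (1 / dict_c e j w i) - - (1 / dict_c e j w (i - 1))"
      by (simp add: sp_of_se_def)
  qed
  then show ?thesis by (simp add: sp_kappa_def) (simp add: sp_of_se_def)
qed

lemma sp_s_sp_of_se:
  assumes "valid_model m" "k \<le> steps m"
  shows "sp_s m (sp_of_se m e) w k = se_chm e w k"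
proof -
  have "(\<Sum>i=1..k. rsb m i * sp_H (sp_of_se m e) w i) = se_chm e w k - se_chm e w 0"
  proof (rule sum_telescope_from_1)
    fix i assume "1 \<le> i" "i \<le> k"
    with rsb_pos[OF assms(1), of i] assms(2)
    show "rsb m i * sp_H (sp_of_se m e) w i = se_chm e w i - se_chm e w (i - 1)"
      by (simp add: sp_of_se_def)
  qed
  then show ?thesis by (simp add: sp_s_def) (simp add: sp_of_se_def)
qed

section \<open>Consequences of an admissible fixed point\<close>

locale se_fixed =
  fixes m :: model and e :: se_vars
  assumes valid: "valid_model m"
    and fixed: "se_fixed_point m e"
    and adm: "se_admissible m e"
begin

lemma steps_eqs: "se_a m e" "se_b m e" "se_c m e e" "se_d m e e"
  using fixed by (auto simp: se_fixed_point_def state_evolution_def)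

lemma nonzero:
  assumes "k \<le> steps m"
  shows "se_cp e w k \<noteq> 0" "se_cm e w k \<noteq> 0" "se_chp e w k \<noteq> 0" "se_chm e w k \<noteq> 0"
  using adm assms by (auto simp: se_admissible_def)

text \<open>The first identity comes from step (a) for z and (b) for x, the second from (c) for x
  and (d) for z. Their right-hand sides coincide, which forces the two hatted families to
  agree.\<close>

lemma precision_add:
  assumes "k \<le> steps m"
  shows "1 / se_chm e w k = 1 / se_cp e w k + 1 / se_cm e w k"
    and "1 / se_chp e w k = 1 / se_cp e w k + 1 / se_cm e w k"
proof -
  have "se_cm e w k = inverse (1 / se_chm e w k - 1 / se_cp e w k)"
    using steps_eqs(1,2) assms unfolding se_a_def se_b_def Let_def by (cases w) blast+
  then show "1 / se_chm e w k = 1 / se_cp e w k + 1 / se_cm e w k"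
    using nonzero(2)[OF assms] by (metis add.commute extrinsic_iff)
  have "se_cp e w k = inverse (1 / se_chp e w k - 1 / se_cm e w k)"
    using steps_eqs(3,4) assms unfolding se_c_def se_d_def Let_def by (cases w) blast+
  then show "1 / se_chp e w k = 1 / se_cp e w k + 1 / se_cm e w k"
    using nonzero(1)[OF assms] by (metis extrinsic_iff)
qed

lemma chp_eq: "k \<le> steps m \<Longrightarrow> se_chp e w k = se_chm e w k"
  using precision_add[of k w] nonzero[of k w] by (metis divide_divide_eq_right mult_1 div_by_1)

text \<open>The sum is symmetric in the two hats, so it does not matter which of them a step solves
  for. Steps (a), (b) give the minus versions, (c), (d) the plus versions.\<close>

lemma hats:
  "se_Dh e 1 w + se_Dh e 2 w = se_Dm e w / (C_const m w * se_chm e w (steps m))"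
  "se_Dh e 1 w + se_Dh e 2 w = se_Dp e w / (C_const m w * se_chp e w (steps m))"
  "se_Fh e 1 w + se_Fh e 2 w = se_Fm e w / (se_chm e w (steps m))\<^sup>2
     - (se_Dm e w)\<^sup>2 / (C_const m w * (se_chm e w (steps m))\<^sup>2)"
  "se_Fh e 1 w + se_Fh e 2 w = se_Fp e w / (se_chp e w (steps m))\<^sup>2
     - (se_Dp e w)\<^sup>2 / (C_const m w * (se_chp e w (steps m))\<^sup>2)"
proof -
  show "se_Dh e 1 w + se_Dh e 2 w = se_Dm e w / (C_const m w * se_chm e w (steps m))"
    using steps_eqs(1,2) unfolding se_a_def se_b_def Let_def
    by (cases w; elim conjE; hypsubst; linarith)
  show "se_Dh e 1 w + se_Dh e 2 w = se_Dp e w / (C_const m w * se_chp e w (steps m))"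
    using steps_eqs(3,4) unfolding se_c_def se_d_def Let_def
    by (cases w; elim conjE; hypsubst; linarith)
  show "se_Fh e 1 w + se_Fh e 2 w = se_Fm e w / (se_chm e w (steps m))\<^sup>2
     - (se_Dm e w)\<^sup>2 / (C_const m w * (se_chm e w (steps m))\<^sup>2)"
    using steps_eqs(1,2) unfolding se_a_def se_b_def Let_def
    by (cases w; elim conjE; hypsubst; linarith)
  show "se_Fh e 1 w + se_Fh e 2 w = se_Fp e w / (se_chp e w (steps m))\<^sup>2
     - (se_Dp e w)\<^sup>2 / (C_const m w * (se_chp e w (steps m))\<^sup>2)"
    using steps_eqs(3,4) unfolding se_c_def se_d_def Let_def
    by (cases w; elim conjE; hypsubst; linarith)
qed

lemma Dp_eq: "se_Dp e w = se_Dm e w"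
proof -
  have "se_Dm e w / (C_const m w * se_chm e w (steps m)) = se_Dp e w / (C_const m w * se_chm e w (steps m))"
    using hats(1,2)[of w] chp_eq[of "steps m" w] by simp
  then show ?thesis
    using C_const_pos[OF valid, of w] nonzero[of "steps m" w] by simp
qed

text \<open>Once D agrees, the correction terms in D squared cancel and only the F terms over a
  common nonzero denominator remain.\<close>

lemma Fp_eq: "se_Fp e w = se_Fm e w"
proof -
  have "se_Fm e w / (se_chm e w (steps m))\<^sup>2 = se_Fp e w / (se_chm e w (steps m))\<^sup>2"
    using hats(3,4)[of w] chp_eq[of "steps m" w] by (simp add: Dp_eq)
  then show ?thesis
    using nonzero[of "steps m" w] by simp
qed

abbreviation "s \<equiv> sp_of_se m e"

lemmas kappa = sp_kappa_sp_of_se[OF valid]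
lemmas s_eq = sp_s_sp_of_se[OF valid]

lemma constants: "sp_constants m s"
  by (simp add: sp_constants_def sp_of_se_def)

text \<open>Precision addition at level 0 is the equation for chi; its difference between levels k
  and k - 1, divided by L_k, is the equation for H.\<close>

lemma matching: "sp_matching m s w"
proof -
  \<comment> \<open>The roles of plus and minus under \<open>dict_c\<close> are swapped between x
    and z, but the sum of both precisions is the same.\<close>
  have chih: "1 / dict_c e 1 w k + 1 / dict_c e 2 w k = 1 / se_chm e w k" if "k \<le> steps m" for k
    using precision_add(1)[OF that] by (cases w) simp_all
  have "0 = sp_Hh s 1 w k + sp_Hh s 2 w k + 1 / rsb m k * (1 / se_chm e w k - 1 / se_chm e w (k - 1))"
    if "k \<in> {1..steps m}" for k
  proof -
    have "1 / dict_c e 1 w k + 1 / dict_c e 2 w k = 1 / se_chm e w k"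
      "1 / dict_c e 1 w (k - 1) + 1 / dict_c e 2 w (k - 1) = 1 / se_chm e w (k - 1)"
      using that by (intro chih; auto)+
    from this[symmetric] show ?thesis
      by (simp add: sp_of_se_def algebra_simps del: One_nat_def)
  qed
  moreover have "sp_chih s 1 w + sp_chih s 2 w = 1 / sp_chi s w"
    using chih[of 0] by (simp add: sp_of_se_def)
  ultimately show ?thesis
    using hats(1,3)[of w] unfolding sp_matching_def Let_def
    by (auto simp: s_eq sp_of_se_sel(1-4,6,7))
qed

lemma linear_x: "sp_linear m s wx"
proof -
  have "\<And>k. k \<le> steps m \<Longrightarrow> se_chm e wx k = E_eig m (\<lambda>l. inverse (1 / se_cp e wx k + l / se_cm e wz k))"
    and "se_Dm e wx = C_const m wx * E_eig m (\<lambda>l. (se_Dh e 2 wx + se_Dh e 2 wz * l)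
        / (1 / se_cp e wx (steps m) + l / se_cm e wz (steps m)))"
    and "se_Fm e wx = C_const m wx * E_eig m (\<lambda>l. (se_Dh e 2 wx + se_Dh e 2 wz * l)\<^sup>2
        / (1 / se_cp e wx (steps m) + l / se_cm e wz (steps m))\<^sup>2) +
      E_eig m (\<lambda>l. (se_Fh e 2 wx + se_Fh e 2 wz * l) / (1 / se_cp e wx (steps m) + l / se_cm e wz (steps m))\<^sup>2)"
    using steps_eqs(2) unfolding se_b_def Let_def by blast+
  then show ?thesis
    by (auto simp: sp_linear_def Let_def kappa sp_of_se_sel inverse_eq_divide mult.commute simp del: C_const.simps)
qed

text \<open>Step (d) speaks of the plus quantities while the dictionary uses the minus ones, so
  their agreement is what closes the gap; for x, step (b) already has minus quantities.\<close>

lemma linear_z: "sp_linear m s wz"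
proof -
  have "\<And>k. k \<le> steps m \<Longrightarrow> se_chp e wz k = 1 / alpha m * E_eig m (\<lambda>l. l / (1 / se_cp e wx k + l / se_cm e wz k))"
    and "se_Dp e wz = C_const m wx / alpha m * E_eig m (\<lambda>l. l * (se_Dh e 2 wx + se_Dh e 2 wz * l)
        / (1 / se_cp e wx (steps m) + l / se_cm e wz (steps m)))"
    and "se_Fp e wz = C_const m wx / alpha m * E_eig m (\<lambda>l. l * (se_Dh e 2 wx + se_Dh e 2 wz * l)\<^sup>2
        / (1 / se_cp e wx (steps m) + l / se_cm e wz (steps m))\<^sup>2) +
      1 / alpha m * E_eig m (\<lambda>l. l * (se_Fh e 2 wx + se_Fh e 2 wz * l)
        / (1 / se_cp e wx (steps m) + l / se_cm e wz (steps m))\<^sup>2)"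
    using steps_eqs(4) unfolding se_d_def Let_def by blast+
  moreover have "se_chm e wz k = se_chp e wz k" if "k \<le> steps m" for k
    using chp_eq[OF that] by simp
  ultimately show ?thesis
    by (auto simp: sp_linear_def Let_def kappa sp_of_se_sel Dp_eq Fp_eq E_eig_r_fun_wz mult.commute
        simp del: C_const.simps r_fun.simps)
qed

lemma sp_v_eq:
  assumes "k \<le> steps m"
  shows "sp_v m s wx k = se_vxm e k" "sp_v m s wz k = se_vzp e k"
  using assms steps_eqs
  by (simp_all add: sp_v_def se_a_def se_c_def Let_def kappa) (simp_all add: sp_of_se_def)

text \<open>For x the equations come from step (c), and the plus quantities must be exchanged for
  minus ones; for z, step (a) gives them directly.\<close>

lemma channel: "sp_channel m s w"
proof (cases w)
  case wx
  have "se_vhxp e k = (if k = 0 then sp_chi s wx else sp_H s wx k)" if "k \<le> steps m" for k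
  proof (cases "k = 0")
    case True
    then show ?thesis
      using steps_eqs(3) chp_eq[of 0 wx] by (simp add: se_c_def Let_def sp_of_se_sel)
  next
    case False
    \<comment> \<open>Solving this recursion for \<open>se_vhxp e k\<close> divides by L_k > 0 and
      yields the increment that defines \<open>sp_H\<close>.\<close>
    with that have "se_chp e wx k = se_chp e wx (k - 1) + rsb m k * se_vhxp e k"
      using steps_eqs(3) unfolding se_c_def Let_def
      by (metis One_nat_def Suc_leI atLeastAtMost_iff neq0_conv)
    with False that rsb_pos[OF valid that] show ?thesis
      by (simp add: sp_of_se_sel chp_eq)
  qed
  moreover have "channel_eqs m wx (se_vxm e) (se_Dh e 1 wx) (se_Fh e 1 wx) (1 / se_cm e wx (steps m))
      (se_Dm e wx) (se_Fm e wx) (se_vhxp e)"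
    using steps_eqs(3) Dp_eq Fp_eq by (simp add: se_c_def Let_def)
  ultimately show ?thesis
    unfolding wx sp_channel_def
    by (subst channel_eqs_cong[where v' = "se_vxm e" and h' = "se_vhxp e"])
       (simp_all add: sp_v_eq kappa sp_of_se_sel(2,3,6,7))
next
  case wz
  have "se_vhzm e k = (if k = 0 then sp_chi s wz else sp_H s wz k)" if "k \<le> steps m" for k
    using steps_eqs(1) that rsb_pos[OF valid that]
    by (auto simp: se_a_def Let_def sp_of_se_def)
  moreover have "channel_eqs m wz (se_vzp e) (se_Dh e 1 wz) (se_Fh e 1 wz) (1 / se_cp e wz (steps m))
      (se_Dm e wz) (se_Fm e wz) (se_vhzm e)"
    using steps_eqs(1) by (simp add: se_a_def Let_def)
  ultimately show ?thesis
    unfolding wz sp_channel_def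
    by (subst channel_eqs_cong[where v' = "se_vzp e" and h' = "se_vhzm e"])
       (simp_all add: sp_v_eq kappa sp_of_se_sel(2,3,6,7))
qed

lemma saddle_point_sp_of_se: "saddle_point m s"
  using constants matching linear_x linear_z channel
  by (auto simp: saddle_point_def all_node)

lemma sp_admissible_sp_of_se: "sp_admissible m s"
proof -
  have "0 < sp_Fh s 1 w" for w
    using adm by (simp add: se_admissible_def sp_of_se_def)
  moreover have "0 < sp_v m s w k" if "k \<le> steps m" for w k
    using adm that by (cases w) (simp_all add: se_admissible_def sp_v_eq)
  moreover have "dict_c e j w k \<noteq> 0" if "k \<le> steps m" for j w k
    using nonzero[OF that] by (cases w) simp_all
  moreover have "AE l in eig_law m. 1 / se_cp e wx k + l * (1 / se_cm e wz k) \<noteq> 0" if "k \<le> steps m" for k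
    using adm that by (simp add: se_admissible_def)
  ultimately show ?thesis
    using nonzero by (simp add: sp_admissible_def kappa s_eq)
qed

end

subsection \<open>From the saddle point to the state evolution\<close>

text \<open>The plus and minus slots of \<open>ch\<close>, D and F receive the same values, as they
  must at an admissible fixed point. The index switch in \<open>se_cp\<close> and
  \<open>se_cm\<close> inverts \<open>dict_c\<close>.\<close>

definition se_of_sp :: "model \<Rightarrow> sp_vars \<Rightarrow> se_vars" where
  "se_of_sp m s = \<lparr>
     se_cp = (\<lambda>w k. 1 / sp_kappa m s (if w = wx then 2 else 1) w k),
     se_cm = (\<lambda>w k. 1 / sp_kappa m s (if w = wx then 1 else 2) w k),
     se_chp = sp_s m s,
     se_chm = sp_s m s,
     se_Dp = sp_D s,
     se_Dm = sp_D s,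
     se_Fp = sp_F s,
     se_Fm = sp_F s,
     se_Dh = sp_Dh s,
     se_Fh = sp_Fh s,
     se_vzp = sp_v m s wz,
     se_vhzm = (\<lambda>k. if k = 0 then sp_chi s wz else sp_H s wz k),
     se_vxm = sp_v m s wx,
     se_vhxp = (\<lambda>k. if k = 0 then sp_chi s wx else sp_H s wx k)\<rparr>"

lemma sp_kappa_0: "sp_kappa m s j w 0 = sp_chih s j w"
  by (simp add: sp_kappa_def)

lemma sp_kappa_step:
  "1 \<le> k \<Longrightarrow> sp_kappa m s j w k = sp_kappa m s j w (k - 1) - rsb m k * sp_Hh s j w k"
  by (cases k) (simp_all add: sp_kappa_def)

lemma sp_s_0: "sp_s m s w 0 = sp_chi s w"
  by (simp add: sp_s_def)

lemma sp_s_step: "1 \<le> k \<Longrightarrow> sp_s m s w k = sp_s m s w (k - 1) + rsb m k * sp_H s w k"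
  by (cases k) (simp_all add: sp_s_def)

text \<open>The index is restricted because \<open>dict_c\<close> reads everything other than 1 as
  2, whereas \<open>sp_kappa\<close> depends on the actual index.\<close>

lemma dict_c_se_of_sp:
  assumes "j \<in> {1, 2}"
  shows "dict_c (se_of_sp m s) j w k = 1 / sp_kappa m s j w k"
  using assms by (cases w) (auto simp: se_of_sp_def)

lemma dictionary_se_of_sp:
  assumes "valid_model m"
  shows "dictionary m (se_of_sp m s) s"
proof -
  have "sp_Hh s j w k = - (1 / rsb m k * (sp_kappa m s j w k - sp_kappa m s j w (k - 1)))"
    if "k \<in> {1..steps m}" for j w k
    using that rsb_pos[OF assms, of k] sp_kappa_step[of k m s j w] by (simp add: field_simps)
  moreover have "sp_H s w k = 1 / rsb m k * (sp_s m s w k - sp_s m s w (k - 1))"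
    if "k \<in> {1..steps m}" for w k
    using that rsb_pos[OF assms, of k] sp_s_step[of k m s w] by (simp add: field_simps)
  ultimately show ?thesis
    by (simp add: dictionary_def dict_c_se_of_sp sp_kappa_0)
       (simp add: se_of_sp_def sp_s_0)
qed

section \<open>Consequences of an admissible saddle point\<close>

locale sp_solution =
  fixes m :: model and s :: sp_vars
  assumes valid: "valid_model m"
    and saddle: "saddle_point m s"
    and adm: "sp_admissible m s"
begin

lemma sp_eqs: "sp_constants m s" "sp_matching m s w" "sp_linear m s w" "sp_channel m s w"
  using saddle by (auto simp: saddle_point_def)

lemma nonzero:
  assumes "k \<le> steps m"
  shows "sp_kappa m s 1 w k \<noteq> 0" "sp_kappa m s 2 w k \<noteq> 0" "sp_s m s w k \<noteq> 0"
  using adm assms by (auto simp: sp_admissible_def)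

lemma C_eq: "sp_C s w = C_const m w"
  using sp_eqs(1) by (cases w) (simp_all add: sp_constants_def)

text \<open>Induction on the level: the base case is the equation for chi, and each equation for H,
  multiplied by L_k, carries the identity one level up.\<close>

lemma precision_add:
  assumes "k \<le> steps m"
  shows "1 / sp_s m s w k = sp_kappa m s 1 w k + sp_kappa m s 2 w k"
  using assms
proof (induction k)
  case 0
  then show ?case
    using sp_eqs(2)[of w] by (simp add: sp_matching_def Let_def sp_kappa_0 sp_s_0)
next
  case (Suc k)
  have "0 = sp_Hh s 1 w (Suc k) + sp_Hh s 2 w (Suc k)
      + 1 / rsb m (Suc k) * (1 / sp_s m s w (Suc k) - 1 / sp_s m s w k)"
    using sp_eqs(2)[of w, unfolded sp_matching_def Let_def] Suc.prems
    by (elim conjE ballE[of _ _ "Suc k"]) simp_all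
  then have "0 = rsb m (Suc k) * (sp_Hh s 1 w (Suc k) + sp_Hh s 2 w (Suc k)
      + 1 / rsb m (Suc k) * (1 / sp_s m s w (Suc k) - 1 / sp_s m s w k))"
    by simp
  also have "\<dots> = rsb m (Suc k) * sp_Hh s 1 w (Suc k) + rsb m (Suc k) * sp_Hh s 2 w (Suc k)
      + (1 / sp_s m s w (Suc k) - 1 / sp_s m s w k)"
    using rsb_pos[OF valid Suc.prems] by (simp add: distrib_left)
  finally show ?case
    using Suc sp_kappa_step[of "Suc k" m s] by simp
qed

text \<open>The equation for chi starts the induction. The equations for H prescribe exactly the
  increments of the expectation, so the two sequences stay equal.\<close>

lemma s_eq:
  assumes "k \<le> steps m"
  shows "sp_s m s w k = E_eig m (\<lambda>l. r_fun m w l / (sp_kappa m s 2 wx k + l * sp_kappa m s 2 wz k))"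
  using assms
proof (induction k)
  case 0
  then show ?case
    using sp_eqs(3)[of w] by (simp add: sp_linear_def Let_def sp_kappa_0 sp_s_0)
next
  case (Suc k)
  have "sp_H s w (Suc k) = 1 / rsb m (Suc k) *
      (E_eig m (\<lambda>l. r_fun m w l / (sp_kappa m s 2 wx (Suc k) + l * sp_kappa m s 2 wz (Suc k)))
       - E_eig m (\<lambda>l. r_fun m w l / (sp_kappa m s 2 wx k + l * sp_kappa m s 2 wz k)))"
    using sp_eqs(3)[of w] Suc.prems by (fastforce simp: sp_linear_def Let_def)
  then show ?case
    using Suc rsb_pos[OF valid Suc.prems] sp_s_step[of "Suc k" m s w] by simp
qed

abbreviation "e \<equiv> se_of_sp m s"

lemma extrinsic:
  assumes "k \<le> steps m"
  shows "inverse (1 / sp_s m s w k - sp_kappa m s 1 w k) = 1 / sp_kappa m s 2 w k"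
    and "inverse (1 / sp_s m s w k - sp_kappa m s 2 w k) = 1 / sp_kappa m s 1 w k"
  using precision_add[OF assms] by (simp_all add: inverse_eq_divide)

lemma hats:
  "sp_Dh s 1 w + sp_Dh s 2 w = sp_D s w / (C_const m w * sp_s m s w (steps m))"
  "sp_Fh s 1 w + sp_Fh s 2 w = sp_F s w / (sp_s m s w (steps m))\<^sup>2
     - (sp_D s w)\<^sup>2 / (C_const m w * (sp_s m s w (steps m))\<^sup>2)"
  using sp_eqs(2)[of w] by (simp_all add: sp_matching_def Let_def C_eq)

text \<open>Steps (a) and (c) solve for the hats with index 2, steps (b) and (d) for those with
  index 1; both forms are therefore kept.\<close>

lemma hats_diff:
  "sp_Dh s 2 w = sp_D s w / (C_const m w * sp_s m s w (steps m)) - sp_Dh s 1 w"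
  "sp_Dh s 1 w = sp_D s w / (C_const m w * sp_s m s w (steps m)) - sp_Dh s 2 w"
  "sp_Fh s 2 w = sp_F s w / (sp_s m s w (steps m))\<^sup>2
     - (sp_D s w)\<^sup>2 / (C_const m w * (sp_s m s w (steps m))\<^sup>2) - sp_Fh s 1 w"
  "sp_Fh s 1 w = sp_F s w / (sp_s m s w (steps m))\<^sup>2
     - (sp_D s w)\<^sup>2 / (C_const m w * (sp_s m s w (steps m))\<^sup>2) - sp_Fh s 2 w"
  using hats[of w] by linarith+

lemma sp_v_cases:
  "sp_v m s w 0 = 1 / sp_kappa m s 1 w 0"
  "1 \<le> k \<Longrightarrow> sp_v m s w k = 1 / rsb m k * (1 / sp_kappa m s 1 w k - 1 / sp_kappa m s 1 w (k - 1))"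
  by (simp_all add: sp_v_def sp_kappa_0)

lemma channel_e: "channel_eqs m w (sp_v m s w) (sp_Dh s 1 w) (sp_Fh s 1 w)
    (sp_kappa m s 1 w (steps m)) (sp_D s w) (sp_F s w) (\<lambda>k. if k = 0 then sp_chi s w else sp_H s w k)"
  using sp_eqs(4) by (simp add: sp_channel_def)

text \<open>Steps (a) and (c) rest on the channel equations, (b) and (d) on the linear ones; the
  extrinsic updates in all four are precision addition.\<close>

lemma se_a_e: "se_a m e"
  unfolding se_a_def Let_def se_of_sp_def
  using channel_e[of wz] hats_diff(1,3)[of wz] extrinsic[of _ wz]
  by (simp add: sp_v_cases sp_s_0 sp_s_step del: C_const.simps)

lemma se_b_e: "se_b m e"
  unfolding se_b_def Let_def se_of_sp_def
  using hats_diff(2,4)[of wx] extrinsic[of _ wx] s_eq[of _ wx] sp_eqs(3)[of wx]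
  by (simp add: sp_linear_def Let_def C_eq inverse_eq_divide mult.commute del: C_const.simps)

lemma se_c_e: "se_c m e e"
  unfolding se_c_def Let_def se_of_sp_def
  using channel_e[of wx] hats_diff(1,3)[of wx] extrinsic[of _ wx]
  by (simp add: sp_v_cases sp_s_0 sp_s_step del: C_const.simps)

lemma se_d_e: "se_d m e e"
  unfolding se_d_def Let_def se_of_sp_def
  using hats_diff(2,4)[of wz] extrinsic[of _ wz] s_eq[of _ wz] sp_eqs(3)[of wz]
  by (simp add: sp_linear_def Let_def C_eq inverse_eq_divide mult.commute E_eig_r_fun_wz
      del: C_const.simps r_fun.simps)

lemma se_fixed_point_se_of_sp: "se_fixed_point m e"
  using se_a_e se_b_e se_c_e se_d_e by (simp add: se_fixed_point_def state_evolution_def)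

lemma se_admissible_se_of_sp: "se_admissible m e"
  using adm by (simp add: se_admissible_def sp_admissible_def se_of_sp_def)

end

text \<open>The dictionary leaves the C constants on one side and the plus versions of
  \<open>ch\<close>, D and F on the other unmentioned, hence an existence claim in each direction,
  with witnesses \<open>sp_of_se\<close> and \<open>se_of_sp\<close>.\<close>

theorem proposition1:
  fixes m :: model
  assumes "valid_model m"
  shows "(\<forall>e. se_fixed_point m e \<and> se_admissible m e \<longrightarrow>
            (\<exists>s. dictionary m e s \<and> saddle_point m s \<and> sp_admissible m s)) \<and>
         (\<forall>s. saddle_point m s \<and> sp_admissible m s \<longrightarrow>
            (\<exists>e. dictionary m e s \<and> se_fixed_point m e \<and> se_admissible m e))"
proof (intro conjI allI impI; elim conjE)
  fix e
  assume "se_fixed_point m e" "se_admissible m e"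
  then interpret se_fixed m e
    using assms by unfold_locales
  show "\<exists>s. dictionary m e s \<and> saddle_point m s \<and> sp_admissible m s"
    using dictionary_sp_of_se saddle_point_sp_of_se sp_admissible_sp_of_se by blast
next
  fix s
  assume "saddle_point m s" "sp_admissible m s"
  then interpret sp_solution m s
    using assms by unfold_locales
  show "\<exists>e. dictionary m e s \<and> se_fixed_point m e \<and> se_admissible m e"
    using dictionary_se_of_sp[OF assms] se_fixed_point_se_of_sp se_admissible_se_of_sp by blast
qed

end
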